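(* Let $G$ and $H$ be graphs on $n$ and $m$ vertices, respectively, and let $X\in M_n$ and $Y\in M_m$. Then $$\|X+\mathcal{S}_G^{\perp}\|_{\mathrm{osy}}\,\|Y+\mathcal{S}_H^{\perp}\|_{\mathrm{osy}}=\|X\otimes Y+\mathcal{S}_{G\boxtimes H}^{\perp}\|_{\mathrm{osy}},$$ that is, $\sigma(G\boxtimes H,X\otimes Y)=\sigma(G,X)\cdot\sigma(H,Y)$.
   Context: $M_n$ denotes the complex $n\times n$ matrices, with matrix units $E_{i,j}$; $M_n\otimes M_m$ is identified with $M_{nm}$. A graph $G$ on $n$ vertices is a symmetric subset $G\subseteq\{1,\dots,n\}^2$ containing no $(i,i)$; $\widetilde G=G\cup\{(i,i):1\le i\le n\}$. The operator system of $G$ is $\mathcal{S}_G=\operatorname{span}\{E_{i,j}:(i,j)\in\widetilde G\}$, and $\mathcal{S}_G^\perp$ is its orthogonal complement in $M_n$ for the inner product $(a,b)=\operatorname{tr}(ab^* )$, i.e. $\mathcal{S}_G^\perp=\operatorname{span}\{E_{i,j}:(i,j)\notin\widetilde G\}$. The strong product $G\boxtimes H$ is the graph on the $nm$ vertices $(i,j)$, $1\le i\le n$, $1\le j\le m$, with $((i,j),(k,l))\in G\boxtimes H$ iff [$(i,k)\in G$ and $j=l$] or [$(j,l)\in H$ and $i=k$] or [$(i,k)\in G$ and $(j,l)\in H$]; then $\mathcal{S}_{G\boxtimes H}=\mathcal{S}_G\otimes\mathcal{S}_H\subseteq M_{nm}$. The operator system quotient norm is $$\sigma(G,X):=\|X+\mathcal{S}_G^{\perp}\|_{\mathrm{osy}}=\inf\Big\{\lambda:\begin{pmatrix}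 \lambda I+K_1 & X+K_2 \\ X^*+K_2^* & \lambda I+K_3 \end{pmatrix}\in M_2(M_n)^+\text{ for some }K_1,K_2,K_3\in\mathcal{S}_G^\perp\Big\},$$ where $M_2(M_n)^+$ is the set of positive semidefinite matrices in $M_{2n}$. *)

theory Defs
  imports "HOL-Analysis.Analysis"
begin

text \<open>
  \<open>M\<^sub>n\<close> is the type \<^typ>\<open>complex^'n^'n\<close> over a finite index type \<open>'n\<close> with \<open>CARD('n) = n\<close>.
  The library has no complex vector space structure on this type (its \<^term>\<open>span\<close> is the real
  span), so complex scalar multiplication is introduced here.
\<close>

definition cscale :: "complex \<Rightarrow> complex^'n^'n \<Rightarrow> complex^'n^'n::finite" where
  "cscale c A = (\<chi> i j. c * A $ i $ j)"

global_interpretation cmat: vector_space "cscale :: complex \<Rightarrow> complex^'n^'n \<Rightarrow> complex^'n^'n::finite"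
  by unfold_locales (simp_all add: cscale_def vec_eq_iff algebra_simps)

definition matrix_unit :: "'n \<Rightarrow> 'n \<Rightarrow> complex^'n^'n::finite" where
  "matrix_unit i j = (\<chi> k l. if k = i \<and> l = j then 1 else 0)"

definition conj_transpose :: "complex^'n^'n \<Rightarrow> complex^'n^'n::finite" where
  "conj_transpose A = (\<chi> i j. cnj (A $ j $ i))"

text \<open>
  Over the complex numbers a matrix with real nonnegative quadratic form is automatically Hermitian.
\<close>

definition pos_semidef :: "complex^'n^'n::finite \<Rightarrow> bool" where
  "pos_semidef A \<longleftrightarrow>
     (\<forall>v::complex^'n. let q = (\<Sum>i\<in>UNIV. (A *v v) $ i * cnj (v $ i)) in q \<in> \<real> \<and> 0 \<le> Re q)"

text \<open>\<open>M\<^sub>2(M\<^sub>n) = M\<^sub>2\<^sub>n\<close> is indexed by the disjoint sum \<open>'n + 'n\<close>.\<close>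

definition block2 ::
  "complex^'n^'n \<Rightarrow> complex^'n^'n \<Rightarrow> complex^'n^'n \<Rightarrow> complex^'n^'n \<Rightarrow> complex^('n + 'n)^('n + 'n::finite)"
  where
  "block2 A B C D = (\<chi> p q. case (p, q) of
      (Inl i, Inl j) \<Rightarrow> A $ i $ j
    | (Inl i, Inr j) \<Rightarrow> B $ i $ j
    | (Inr i, Inl j) \<Rightarrow> C $ i $ j
    | (Inr i, Inr j) \<Rightarrow> D $ i $ j)"

text \<open>\<open>M\<^sub>n \<otimes> M\<^sub>m = M\<^sub>n\<^sub>m\<close> is indexed by pairs, as are the vertices of the strong product.\<close>

definition kronecker ::
  "complex^'n^'n \<Rightarrow> complex^'m^'m \<Rightarrow> complex^('n::finite \<times> 'm::finite)^('n \<times> 'm)" where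
  "kronecker X Y = (\<chi> p q. X $ fst p $ fst q * Y $ snd p $ snd q)"

definition is_graph :: "'n rel \<Rightarrow> bool" where
  "is_graph G \<longleftrightarrow> sym G \<and> irrefl G"

definition strong_product :: "'n rel \<Rightarrow> 'm rel \<Rightarrow> ('n \<times> 'm) rel" where
  "strong_product G H = {((i, j), (k, l)) | i j k l.
     ((i, k) \<in> G \<and> j = l) \<or> ((j, l) \<in> H \<and> i = k) \<or> ((i, k) \<in> G \<and> (j, l) \<in> H)}"

definition graph_system :: "'n rel \<Rightarrow> (complex^'n^'n::finite) set" where
  "graph_system G = cmat.span {matrix_unit i j | i j. (i, j) \<in> G \<union> Id}"

definition orth_compl :: "(complex^'n^'n::finite) set \<Rightarrow> (complex^'n^'n) set" where
  "orth_compl S = {A. \<forall>B\<in>S. trace (A ** conj_transpose B) = 0}"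

lemma orth_compl_graph_system:
  "A \<in> orth_compl (graph_system G) \<longleftrightarrow> (\<forall>i j. (i, j) \<in> G \<union> Id \<longrightarrow> A $ i $ j = 0)"
proof
  have tr: "trace (A ** conj_transpose B) = (\<Sum>i\<in>UNIV. \<Sum>j\<in>UNIV. A $ i $ j * cnj (B $ i $ j))" for B
    by (simp add: trace_def matrix_matrix_mult_def conj_transpose_def)
  { assume L: "A \<in> orth_compl (graph_system G)"
    show "\<forall>i j. (i, j) \<in> G \<union> Id \<longrightarrow> A $ i $ j = 0"
    proof (intro allI impI)
      fix i j assume "(i, j) \<in> G \<union> Id"
      then have "matrix_unit i j \<in> graph_system G"
        unfolding graph_system_def by (intro cmat.span_base) blast
      then have "0 = (\<Sum>k\<in>UNIV. \<Sum>l\<in>UNIV. A $ k $ l * cnj (matrix_unit i j $ k $ l))"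
        using L tr unfolding orth_compl_def by auto
      also have "\<dots> = (\<Sum>k\<in>UNIV. \<Sum>l\<in>UNIV. if k = i then (if l = j then A $ k $ l else 0) else 0)"
        by (intro sum.cong refl) (simp add: matrix_unit_def)
      also have "\<dots> = (\<Sum>k\<in>UNIV. if k = i then A $ k $ j else 0)"
        by (intro sum.cong refl) simp
      finally show "A $ i $ j = 0" by simp
    qed }
  { assume R: "\<forall>i j. (i, j) \<in> G \<union> Id \<longrightarrow> A $ i $ j = 0"
    have Z: "B $ i $ j = 0" if "B \<in> graph_system G" "(i, j) \<notin> G \<union> Id" for B i j
      using that(1) unfolding graph_system_def
    proof (induction rule: cmat.span_induct_alt)
      case base then show ?case by simp
    next
      case (step c x y)
      then show ?case using that(2) by (auto simp: cscale_def matrix_unit_def split: if_splits)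
    qed
    show "A \<in> orth_compl (graph_system G)"
      unfolding orth_compl_def tr mem_Collect_eq
      using R Z by (intro ballI sum.neutral) (metis complex_cnj_zero mult_eq_0_iff) }
qed

text \<open>
  The quotient norm \<open>\<parallel>X + S\<^sub>G\<^sup>\<bottom>\<parallel>\<^bsub>osy\<^esub>\<close>. Members of \<open>S\<^sub>G\<^sup>\<bottom>\<close> have zero diagonal, so every admissible
  \<open>t\<close> is nonnegative and the infimum over the reals is that of a nonempty set bounded below.
\<close>

definition osy_norm :: "'n rel \<Rightarrow> complex^'n^'n::finite \<Rightarrow> real" where
  "osy_norm G X = Inf {t::real. \<exists>K1 K2 K3.
     K1 \<in> orth_compl (graph_system G) \<and> K2 \<in> orth_compl (graph_system G) \<and>
     K3 \<in> orth_compl (graph_system G) \<and>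
     pos_semidef (block2 (mat (of_real t) + K1) (X + K2)
                         (conj_transpose X + conj_transpose K2) (mat (of_real t) + K3))}"

end

theory Submission
  imports Defs
begin

text \<open>
  The quotient norm is the value of a semidefinite programme: it is the infimum of those \<open>t\<close> for
  which the entries of the block matrix \<open>(t I, X; X\<^sup>*, t I)\<close> at the positions belonging to the graph
  can be completed to a positive semidefinite matrix. The theorem holds because feasible points of
  this programme, and also feasible points of the dual programme, can be tensored.

  Primal side. If \<open>M\<close> and \<open>N\<close> are completions for \<open>(s, X)\<close> and \<open>(t, Y)\<close>, then the compression of
  \<open>M \<otimes> N\<close> to the two diagonal corners (the products of the upper left blocks, of the upper right
  blocks, and so on) is a completion for \<open>(s t, X \<otimes> Y)\<close>, since a position of \<open>G \<boxtimes> H\<close> is a pair of a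
  position of \<open>G\<close> and a position of \<open>H\<close>. So the norm of \<open>X \<otimes> Y\<close> is at most the product
  (\<open>feasible_mult\<close>).

  Dual side. A certificate is a positive semidefinite \<open>W = (P, Z; Z\<^sup>*, Q)\<close> supported on the positions
  of the graph. Multiplying a completion entrywise with \<open>W\<close> gives a positive semidefinite matrix in
  which only the prescribed entries survive; Cauchy--Schwarz for the indicator vectors of the two
  blocks then says \<open>\<bar>\<Sum> X\<^sub>i\<^sub>j Z\<^sub>i\<^sub>j\<bar>\<^sup>2 \<le> t\<^sup>2 (tr P) (tr Q)\<close>. With the normalisation \<open>(tr P) (tr Q) \<le> 1\<close>
  the pairing with \<open>W\<close> is a lower bound for the norm (\<open>weak_duality\<close>), and a separating hyperplane
  yields a certificate that reaches the norm (\<open>strong_duality\<close>). Support, normalisation and pairing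
  are all multiplicative under the compressed tensor product, so tensoring optimal certificates for
  \<open>X\<close> and \<open>Y\<close> shows that the norm of \<open>X \<otimes> Y\<close> is at least the product.

  Both halves, and the entrywise product, need only one fact on positivity,
  \<open>pos_semidef_pullback_mult\<close>. It is reduced to matrices of rank one by the induction principle
  \<open>pos_semidef_induct\<close>, which is Cholesky elimination.
\<close>

section \<open>Sesquilinear forms and the Cauchy--Schwarz inequality\<close>

definition sesq :: "complex^'k^'k \<Rightarrow> complex^'k \<Rightarrow> complex^'k \<Rightarrow> complex" where
  "sesq A u v = (\<Sum>i\<in>UNIV. (A *v v) $ i * cnj (u $ i))"

definition outer :: "complex^'k \<Rightarrow> complex^'k^'k" where
  "outer b = (\<chi> i j. b $ i * cnj (b $ j))"

lemma pos_semidef_iff_sesq: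
  "pos_semidef A \<longleftrightarrow> (\<forall>v. sesq A v v \<in> \<real> \<and> 0 \<le> Re (sesq A v v))"
  by (simp add: pos_semidef_def sesq_def Let_def)

lemma sesq_alt: "sesq A u v = (\<Sum>i\<in>UNIV. \<Sum>j\<in>UNIV. A $ i $ j * v $ j * cnj (u $ i))"
  by (simp add: sesq_def matrix_vector_mult_def sum_distrib_right)

lemma sesq_add_right: "sesq A u (v + w) = sesq A u v + sesq A u w"
  by (simp add: sesq_def matrix_vector_right_distrib algebra_simps sum.distrib)

lemma sesq_add_left: "sesq A (u + w) v = sesq A u v + sesq A w v"
  by (simp add: sesq_def algebra_simps sum.distrib)

lemma sesq_scale_right: "sesq A u (c *s v) = c * sesq A u v"
  by (simp add: sesq_def vector_scalar_commute sum_distrib_left algebra_simps)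

lemma sesq_scale_left: "sesq A (c *s u) v = cnj c * sesq A u v"
  by (simp add: sesq_def sum_distrib_left algebra_simps)

lemmas sesq_linear = sesq_add_right sesq_add_left sesq_scale_right sesq_scale_left

lemma sesq_add_matrix: "sesq (A + B) u v = sesq A u v + sesq B u v"
  by (simp add: sesq_alt algebra_simps sum.distrib)

lemma sesq_scaleR_matrix: "sesq (r *\<^sub>R A) u v = r *\<^sub>R sesq A u v"
  by (simp add: sesq_alt scaleR_sum_right)

lemma sesq_axis_left: "sesq A (axis i 1) v = (A *v v) $ i"
proof -
  have "sesq A (axis i 1) v = (\<Sum>k\<in>UNIV. if k = i then (A *v v) $ k else 0)"
    unfolding sesq_def by (intro sum.cong refl) (simp add: axis_def)
  then show ?thesis by simp
qed

lemma sesq_axis: "sesq A (axis i 1) (axis j 1) = A $ i $ j"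
proof -
  have "(A *v axis j 1) $ i = (\<Sum>k\<in>UNIV. if k = j then A $ i $ k else 0)"
    unfolding matrix_vector_mult_def vec_lambda_beta
    by (intro sum.cong refl) (simp add: axis_def)
  then show ?thesis by (simp add: sesq_axis_left)
qed

lemma sesq_outer: "sesq (outer b) v v = of_real ((cmod (\<Sum>j\<in>UNIV. v $ j * cnj (b $ j)))\<^sup>2)"
proof -
  have "sesq (outer b) v v
      = (\<Sum>i\<in>UNIV. \<Sum>j\<in>UNIV. (b $ i * cnj (v $ i)) * (v $ j * cnj (b $ j)))"
    unfolding sesq_alt by (intro sum.cong refl) (simp add: outer_def algebra_simps)
  also have "\<dots> = (\<Sum>i\<in>UNIV. b $ i * cnj (v $ i)) * (\<Sum>j\<in>UNIV. v $ j * cnj (b $ j))"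
    by (simp add: sum_product)
  also have "(\<Sum>i\<in>UNIV. b $ i * cnj (v $ i)) = cnj (\<Sum>j\<in>UNIV. v $ j * cnj (b $ j))"
    by (simp add: mult.commute)
  also have "cnj (\<Sum>j\<in>UNIV. v $ j * cnj (b $ j)) * (\<Sum>j\<in>UNIV. v $ j * cnj (b $ j))
      = of_real ((cmod (\<Sum>j\<in>UNIV. v $ j * cnj (b $ j)))\<^sup>2)"
    by (subst mult.commute, rule complex_norm_square[symmetric])
  finally show ?thesis .
qed

lemma pos_semidef_outer: "pos_semidef (outer b)"
  by (simp add: pos_semidef_iff_sesq sesq_outer del: of_real_power)

lemma pos_semidef_zero: "pos_semidef 0"
  by (simp add: pos_semidef_iff_sesq sesq_alt)

lemma pos_semidef_add: "pos_semidef A \<Longrightarrow> pos_semidef B \<Longrightarrow> pos_semidef (A + B)"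
  by (simp add: pos_semidef_iff_sesq sesq_add_matrix)

lemma pos_semidef_scaleR: "pos_semidef A \<Longrightarrow> 0 \<le> r \<Longrightarrow> pos_semidef (r *\<^sub>R A)"
  by (simp add: pos_semidef_iff_sesq sesq_scaleR_matrix complex_is_Real_iff)

text \<open>
  Polarization: the form is real at \<open>u + v\<close> and at \<open>u + i v\<close>, and these two conditions are the real and
  the imaginary part of the claim.
\<close>

lemma pos_semidef_sesq_commute:
  assumes "pos_semidef A"
  shows "sesq A v u = cnj (sesq A u v)"
proof -
  have r: "Im (sesq A w w) = 0" for w
    using assms by (simp add: pos_semidef_iff_sesq complex_is_Real_iff)
  have "Im (sesq A u v) + Im (sesq A v u) = 0"
    using r[of "u + v"] r[of u] r[of v] by (simp add: sesq_linear)
  moreover have "Re (sesq A u v) - Re (sesq A v u) = 0"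
    using r[of "u + \<i> *s v"] r[of u] r[of v] by (simp add: sesq_linear)
  ultimately show ?thesis by (simp add: complex_eq_iff)
qed

lemma pos_semidef_hermitian: "pos_semidef A \<Longrightarrow> A $ j $ i = cnj (A $ i $ j)"
  using pos_semidef_sesq_commute[of A "axis j 1" "axis i 1"] by (simp add: sesq_axis)

lemma pos_semidef_diag: "pos_semidef A \<Longrightarrow> A $ i $ i \<in> \<real> \<and> 0 \<le> Re (A $ i $ i)"
  unfolding pos_semidef_iff_sesq by (drule spec[of _ "axis i 1"]) (simp add: sesq_axis)

lemma pos_semidef_Cauchy_Schwarz:
  assumes A: "pos_semidef A"
  shows "(cmod (sesq A u v))\<^sup>2 \<le> Re (sesq A u u) * Re (sesq A v v)"
proof -
  define z a b where "z = sesq A u v" and "a = Re (sesq A u u)" and "b = Re (sesq A v v)"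
  have nonneg: "0 \<le> a" "0 \<le> b" using A unfolding a_def b_def by (simp_all add: pos_semidef_iff_sesq)
  have zvu: "sesq A v u = cnj z" unfolding z_def by (rule pos_semidef_sesq_commute[OF A])
  have key: "0 \<le> b - 2 * r * (cmod z)\<^sup>2 + r\<^sup>2 * (cmod z)\<^sup>2 * a" for r :: real
  proof -
    \<comment> \<open>The form at \<open>v - r z u\<close> is a real quadratic polynomial in \<open>r\<close>; this is the classical
      discriminant argument.\<close>
    define c where "c = - (of_real r * z)"
    have "0 \<le> Re (sesq A (v + c *s u) (v + c *s u))"
      using A by (simp add: pos_semidef_iff_sesq)
    also have "sesq A (v + c *s u) (v + c *s u)
        = sesq A v v + c * cnj z + cnj c * z + cnj c * c * sesq A u u"
      using zvu by (simp add: sesq_linear z_def algebra_simps)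
    also have "Re \<dots> = b - 2 * r * (cmod z)\<^sup>2 + Re (cnj c * c * sesq A u u)"
      by (simp add: c_def b_def cmod_power2) (simp add: power2_eq_square algebra_simps)
    also have "cnj c * c = of_real (r\<^sup>2 * (cmod z)\<^sup>2)"
    proof -
      have "cnj c * c = of_real ((cmod c)\<^sup>2)" by (metis complex_norm_square mult.commute)
      then show ?thesis by (simp add: c_def norm_mult power_mult_distrib)
    qed
    finally show ?thesis by (simp add: a_def)
  qed
  have "(cmod z)\<^sup>2 \<le> a * b"
  proof (cases "a = 0")
    case True
    have "z = 0"
    proof (rule ccontr)
      assume "z \<noteq> 0"
      then have "(cmod z)\<^sup>2 > 0" by simp
      \<comment> \<open>For \<open>a = 0\<close> the polynomial is affine in \<open>r\<close>, and this \<open>r\<close> gives it the value \<open>-1\<close>.\<close>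
      then show False using key[of "(b + 1) / (2 * (cmod z)\<^sup>2)"] True by (simp add: field_simps)
    qed
    then show ?thesis using True by simp
  next
    case False
    then have "a > 0" using nonneg by simp
    then show ?thesis using key[of "1 / a"] by (simp add: field_simps power2_eq_square)
  qed
  then show ?thesis by (simp add: z_def a_def b_def)
qed

section \<open>The cone generated by the matrices of rank one\<close>

text \<open>
  Every positive semidefinite matrix is a sum of matrices \<open>b b\<^sup>*\<close>, stated as an induction principle.
  A nonzero diagonal entry \<open>a\<close> at \<open>i\<close> is eliminated by subtracting \<open>b b\<^sup>*\<close> with \<open>b\<close> the \<open>i\<close>-th column
  divided by \<open>\<surd>a\<close>: positivity survives by Cauchy--Schwarz against the \<open>i\<close>-th unit vector, and zeros on
  the diagonal stay zero since their whole rows vanish. A positive semidefinite matrix with zero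
  diagonal is zero.
\<close>

lemma pos_semidef_induct [consumes 1, case_names zero outer]:
  fixes A :: "complex^'k^'k"
  assumes A: "pos_semidef A"
    and zero: "P 0"
    and outer: "\<And>A b. pos_semidef A \<Longrightarrow> P A \<Longrightarrow> P (A + outer b)"
  shows "P A"
  using A
proof (induction "card {i. A $ i $ i \<noteq> 0}" arbitrary: A rule: less_induct)
  case less
  have CS: "(cmod (A $ i $ j))\<^sup>2 \<le> Re (A $ i $ i) * Re (A $ j $ j)" for i j
    using pos_semidef_Cauchy_Schwarz[OF less.prems, of "axis i 1" "axis j 1"]
    by (simp add: sesq_axis)
  show ?case
  proof (cases "\<exists>i. A $ i $ i \<noteq> 0")
    case False
    then have "A = 0" using CS by (simp add: vec_eq_iff)
    then show ?thesis using zero by simp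
  next
    case True
    then obtain i where i: "A $ i $ i \<noteq> 0" by blast
    define a where "a = Re (A $ i $ i)"
    have Aii: "A $ i $ i = of_real a" and a: "a > 0"
      using pos_semidef_diag[OF less.prems, of i] i
      by (auto simp: a_def complex_is_Real_iff complex_eq_iff)
    define b where "b = (\<chi> j. A $ j $ i / of_real (sqrt a))"
    define B where "B = A - outer b"
    have outer_b: "outer b $ j $ k = A $ j $ i * cnj (A $ k $ i) / of_real a" for j k
    proof -
      have "complex_of_real (sqrt a) * of_real (sqrt a) = of_real a"
        unfolding of_real_mult[symmetric] using a by simp
      moreover have "outer b $ j $ k
          = A $ j $ i * cnj (A $ k $ i) / (of_real (sqrt a) * of_real (sqrt a))"
        by (simp add: outer_def b_def)
      ultimately show ?thesis by (simp only:)
    qed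
    have sesq_B: "sesq A v v = sesq B v v + sesq (outer b) v v" for v
      using sesq_add_matrix[of B "outer b" v v] by (simp add: B_def)
    have outer_v: "sesq (outer b) v v = of_real ((cmod (sesq A (axis i 1) v))\<^sup>2 / a)" for v
    proof -
      have conj_col: "cnj (A $ j $ i) = A $ i $ j" for j
        by (rule pos_semidef_hermitian[OF less.prems, symmetric])
      have "(\<Sum>j\<in>UNIV. v $ j * cnj (b $ j)) = (\<Sum>j\<in>UNIV. A $ i $ j * v $ j) / of_real (sqrt a)"
        by (simp add: b_def conj_col sum_divide_distrib mult.commute)
      also have "(\<Sum>j\<in>UNIV. A $ i $ j * v $ j) = sesq A (axis i 1) v"
        by (simp add: sesq_axis_left matrix_vector_mult_def)
      finally show ?thesis unfolding sesq_outer using a by (simp add: norm_divide power_divide)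
    qed
    have B: "pos_semidef B"
      unfolding pos_semidef_iff_sesq
    proof (intro allI conjI)
      fix v
      have "sesq A v v \<in> \<real>" using less.prems by (simp add: pos_semidef_iff_sesq)
      moreover have "sesq (outer b) v v \<in> \<real>" by (simp add: outer_v del: of_real_divide of_real_power)
      ultimately show "sesq B v v \<in> \<real>" using sesq_B[of v] by (metis Reals_diff add_diff_cancel_right')
      have "(cmod (sesq A (axis i 1) v))\<^sup>2 \<le> a * Re (sesq A v v)"
        using pos_semidef_Cauchy_Schwarz[OF less.prems, of "axis i 1" v] by (simp add: sesq_axis a_def)
      then have "(cmod (sesq A (axis i 1) v))\<^sup>2 / a \<le> Re (sesq A v v)"
        using a by (simp add: field_simps)
      then show "0 \<le> Re (sesq B v v)"
        unfolding sesq_B outer_v by simp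
    qed
    have "B $ i $ i = 0" using a by (simp add: B_def outer_b Aii)
    moreover have "B $ j $ j = 0" if "A $ j $ j = 0" for j
      using CS[of j i] that by (simp add: B_def outer_b)
    ultimately have "{j. B $ j $ j \<noteq> 0} \<subset> {j. A $ j $ j \<noteq> 0}"
      using i by blast
    then have "card {j. B $ j $ j \<noteq> 0} < card {j. A $ j $ j \<noteq> 0}"
      by (simp add: psubset_card_mono)
    then have "P B" using less.hyps B by blast
    from outer[OF B this, of b] show ?thesis by (simp add: B_def)
  qed
qed

text \<open>
  With \<open>f = g = id\<close> this is the entrywise (Schur) product, with the two projections of a product
  type it is the Kronecker product. The compressed tensor product of \<open>2 \<times> 2\<close> block matrices is a
  further instance.
\<close>

definition pullback_mult ::
  "('k \<Rightarrow> 'i::finite) \<Rightarrow> ('k \<Rightarrow> 'j::finite) \<Rightarrow> complex^'i^'i \<Rightarrow> complex^'j^'j \<Rightarrow> complex^'k^'k::finite"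
  where "pullback_mult f g A B = (\<chi> x y. A $ f x $ f y * B $ g x $ g y)"

text \<open>
  On matrices of rank one, \<open>a a\<^sup>*\<close> and \<open>b b\<^sup>*\<close> are sent to \<open>c c\<^sup>*\<close> with \<open>c\<^sub>x = a\<^bsub>f x\<^esub> b\<^bsub>g x\<^esub>\<close>. The product is
  biadditive, so one induction for each factor gives the general case.
\<close>

lemma pos_semidef_pullback_mult:
  assumes A: "pos_semidef A" and B: "pos_semidef B"
  shows "pos_semidef (pullback_mult f g A B)"
proof -
  have *: "pos_semidef (pullback_mult f g A (outer b))" for b
    using A
  proof (induction rule: pos_semidef_induct)
    case zero
    have "pullback_mult f g 0 (outer b) = 0" by (simp add: pullback_mult_def vec_eq_iff)
    then show ?case by (simp add: pos_semidef_zero)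
  next
    case (outer A a)
    have "pullback_mult f g (A + outer a) (outer b)
        = pullback_mult f g A (outer b) + outer (\<chi> x. a $ f x * b $ g x)"
      by (simp add: pullback_mult_def vec_eq_iff outer_def algebra_simps)
    then show ?case using outer by (simp add: pos_semidef_add pos_semidef_outer)
  qed
  show ?thesis
    using B
  proof (induction rule: pos_semidef_induct)
    case zero
    have "pullback_mult f g A 0 = 0" by (simp add: pullback_mult_def vec_eq_iff)
    then show ?case by (simp add: pos_semidef_zero)
  next
    case (outer B b)
    have "pullback_mult f g A (B + outer b) = pullback_mult f g A B + pullback_mult f g A (outer b)"
      by (simp add: pullback_mult_def vec_eq_iff algebra_simps)
    then show ?case using outer * by (simp add: pos_semidef_add)
  qed
qed

lemma sesq_self_real_of_hermitian:
  assumes "\<And>i j. A $ j $ i = cnj (A $ i $ j)"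
  shows "sesq A v v \<in> \<real>"
proof -
  have "cnj (sesq A v v) = (\<Sum>i\<in>UNIV. \<Sum>j\<in>UNIV. A $ j $ i * cnj (v $ j) * v $ i)"
    unfolding sesq_alt cnj_sum by (intro sum.cong refl) (simp add: assms[symmetric])
  also have "\<dots> = sesq A v v"
    unfolding sesq_alt by (subst sum.swap) (intro sum.cong refl, simp)
  finally show ?thesis by (simp add: Reals_cnj_iff)
qed

lemma sesq_mat: "sesq (mat (of_real c)) v v = of_real (c * (norm v)\<^sup>2)"
proof -
  have "(mat (of_real c) *v v) $ i = (\<Sum>j\<in>UNIV. if i = j then of_real c * v $ j else 0)" for i
    unfolding matrix_vector_mult_def vec_lambda_beta
    by (intro sum.cong refl) (simp add: mat_def)
  then have "sesq (mat (of_real c)) v v = of_real c * (\<Sum>i\<in>UNIV. v $ i * cnj (v $ i))"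
    by (simp add: sesq_def sum_distrib_left algebra_simps)
  also have "(\<Sum>i\<in>UNIV. v $ i * cnj (v $ i)) = of_real (\<Sum>i\<in>UNIV. (norm (v $ i))\<^sup>2)"
    by (simp only: complex_norm_square[symmetric] of_real_sum)
  also have "(\<Sum>i\<in>UNIV. (norm (v $ i))\<^sup>2) = (norm v)\<^sup>2"
    by (simp add: norm_vec_def L2_set_def sum_nonneg)
  finally show ?thesis by simp
qed

text \<open>
  The sum of the absolute values of all entries is a constant that works, because every coordinate of
  \<open>v\<close> is bounded by its norm.
\<close>

lemma hermitian_plus_large_mat_pos_semidef:
  fixes A :: "complex^'k^'k"
  assumes herm: "\<And>i j. A $ j $ i = cnj (A $ i $ j)"
  shows "\<exists>c. pos_semidef (A + mat (of_real c))"
proof -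
  define c where "c = (\<Sum>i\<in>UNIV. \<Sum>j\<in>UNIV. cmod (A $ i $ j))"
  have "sesq (A + mat (of_real c)) v v \<in> \<real> \<and> 0 \<le> Re (sesq (A + mat (of_real c)) v v)" for v
  proof -
    have real: "sesq A v v \<in> \<real>" using herm by (rule sesq_self_real_of_hermitian)
    have "cmod (sesq A v v) \<le> (\<Sum>i\<in>UNIV. \<Sum>j\<in>UNIV. cmod (A $ i $ j * v $ j * cnj (v $ i)))"
      unfolding sesq_alt by (intro norm_sum[THEN order_trans] sum_mono norm_sum)
    also have "\<dots> \<le> (\<Sum>i\<in>UNIV. \<Sum>j\<in>UNIV. cmod (A $ i $ j) * (norm v)\<^sup>2)"
    proof (intro sum_mono)
      fix i j
      have "cmod (v $ j) * cmod (v $ i) \<le> norm v * norm v"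
        by (intro mult_mono Finite_Cartesian_Product.norm_nth_le) auto
      then show "cmod (A $ i $ j * v $ j * cnj (v $ i)) \<le> cmod (A $ i $ j) * (norm v)\<^sup>2"
        by (simp add: norm_mult power2_eq_square mult.assoc mult_left_mono)
    qed
    also have "\<dots> = c * (norm v)\<^sup>2" by (simp add: c_def sum_distrib_right)
    finally have "- (c * (norm v)\<^sup>2) \<le> Re (sesq A v v)"
      using abs_Re_le_cmod[of "sesq A v v"] by linarith
    moreover have "sesq (A + mat (of_real c)) v v = sesq A v v + of_real (c * (norm v)\<^sup>2)"
      by (simp only: sesq_add_matrix sesq_mat)
    ultimately show ?thesis using real by (auto simp: Reals_add)
  qed
  then have "pos_semidef (A + mat (of_real c))" by (simp only: pos_semidef_iff_sesq simp_thms)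
  then show ?thesis ..
qed

section \<open>The quotient norm as a completion problem\<close>

text \<open>
  The positions of the \<open>2 \<times> 2\<close> block matrix at which elements of \<open>S\<^sub>G\<^sup>\<bottom>\<close> vanish in each block; exactly
  there the block matrix in the definition of the norm is prescribed.
\<close>

definition doubled_pattern :: "'n rel \<Rightarrow> ('n + 'n) rel" where
  "doubled_pattern G = {(x, y). (case_sum id id x, case_sum id id y) \<in> G \<union> Id}"

definition partial_block :: "real \<Rightarrow> complex^'n^'n::finite \<Rightarrow> complex^('n + 'n)^('n + 'n)" where
  "partial_block t X = block2 (mat (of_real t)) X (conj_transpose X) (mat (of_real t))"

definition feasible :: "'n rel \<Rightarrow> complex^'n^'n::finite \<Rightarrow> real set" where
  "feasible G X = {t. \<exists>M. pos_semidef M \<and>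
     (\<forall>(x, y)\<in>doubled_pattern G. M $ x $ y = partial_block t X $ x $ y)}"

lemma partial_block_simps [simp]:
  "partial_block t X $ Inl i $ Inl j = (if i = j then of_real t else 0)"
  "partial_block t X $ Inl i $ Inr j = X $ i $ j"
  "partial_block t X $ Inr i $ Inl j = cnj (X $ j $ i)"
  "partial_block t X $ Inr i $ Inr j = (if i = j then of_real t else 0)"
  by (simp_all add: partial_block_def block2_def mat_def conj_transpose_def)

lemma doubled_pattern_simps [simp]:
  "(Inl i, Inl j) \<in> doubled_pattern G \<longleftrightarrow> (i, j) \<in> G \<union> Id"
  "(Inl i, Inr j) \<in> doubled_pattern G \<longleftrightarrow> (i, j) \<in> G \<union> Id"
  "(Inr i, Inl j) \<in> doubled_pattern G \<longleftrightarrow> (i, j) \<in> G \<union> Id"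
  "(Inr i, Inr j) \<in> doubled_pattern G \<longleftrightarrow> (i, j) \<in> G \<union> Id"
  by (auto simp: doubled_pattern_def)

lemma partial_block_hermitian: "partial_block t X $ y $ x = cnj (partial_block t X $ x $ y)"
  by (cases x; cases y) auto

text \<open>
  A completion is automatically Hermitian, so that its blocks determine \<open>K\<^sub>1\<close>, \<open>K\<^sub>2\<close>, \<open>K\<^sub>3\<close> and the lower
  left block has the required form. In the other direction the symmetry of \<open>G\<close> carries the vanishing
  of \<open>K\<^sub>2\<close> over to \<open>K\<^sub>2\<^sup>*\<close>.
\<close>

lemma osy_norm_eq_Inf_feasible:
  fixes X :: "complex^'n^'n"
  assumes G: "is_graph G"
  shows "osy_norm G X = Inf (feasible G X)"
proof -
  have "(\<exists>K1 K2 K3.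
     K1 \<in> orth_compl (graph_system G) \<and> K2 \<in> orth_compl (graph_system G) \<and>
     K3 \<in> orth_compl (graph_system G) \<and>
     pos_semidef (block2 (mat (of_real t) + K1) (X + K2)
                         (conj_transpose X + conj_transpose K2) (mat (of_real t) + K3)))
    \<longleftrightarrow> t \<in> feasible G X" (is "?L t \<longleftrightarrow> _") for t
  proof
    assume "?L t"
    then obtain K1 K2 K3 where K:
      "\<And>i j. (i, j) \<in> G \<union> Id \<Longrightarrow> K1 $ i $ j = 0"
      "\<And>i j. (i, j) \<in> G \<union> Id \<Longrightarrow> K2 $ i $ j = 0"
      "\<And>i j. (i, j) \<in> G \<union> Id \<Longrightarrow> K3 $ i $ j = 0"
      and psd: "pos_semidef (block2 (mat (of_real t) + K1) (X + K2)
                         (conj_transpose X + conj_transpose K2) (mat (of_real t) + K3))"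
        (is "pos_semidef ?M")
      unfolding orth_compl_graph_system by blast
    have "?M $ x $ y = partial_block t X $ x $ y" if "(x, y) \<in> doubled_pattern G" for x y
    proof -
      have "K2 $ j $ i = 0" if "(i, j) \<in> G \<union> Id" for i j
        using G that by (intro K(2)) (auto simp: is_graph_def dest: symD)
      with that K show ?thesis
        by (cases x; cases y) (auto simp: block2_def mat_def conj_transpose_def)
    qed
    with psd show "t \<in> feasible G X" unfolding feasible_def by blast
  next
    assume "t \<in> feasible G X"
    then obtain M where psd: "pos_semidef M"
      and M: "\<And>x y. (x, y) \<in> doubled_pattern G \<Longrightarrow> M $ x $ y = partial_block t X $ x $ y"
      unfolding feasible_def by blast
    define K1 :: "complex^'n^'n" where "K1 = (\<chi> i j. M $ Inl i $ Inl j - mat (of_real t) $ i $ j)"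
    define K2 :: "complex^'n^'n" where "K2 = (\<chi> i j. M $ Inl i $ Inr j - X $ i $ j)"
    define K3 :: "complex^'n^'n" where "K3 = (\<chi> i j. M $ Inr i $ Inr j - mat (of_real t) $ i $ j)"
    have "block2 (mat (of_real t) + K1) (X + K2)
                         (conj_transpose X + conj_transpose K2) (mat (of_real t) + K3) $ x $ y
        = M $ x $ y" for x y
    proof -
      have "cnj (M $ Inl i $ Inr j) = M $ Inr j $ Inl i" for i j
        by (rule pos_semidef_hermitian[OF psd, symmetric])
      then show ?thesis
        by (cases x; cases y) (auto simp: block2_def K1_def K2_def K3_def conj_transpose_def)
    qed
    then have "block2 (mat (of_real t) + K1) (X + K2)
                         (conj_transpose X + conj_transpose K2) (mat (of_real t) + K3) = M"
      by (simp add: vec_eq_iff)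
    moreover have "K1 \<in> orth_compl (graph_system G)" "K2 \<in> orth_compl (graph_system G)"
      "K3 \<in> orth_compl (graph_system G)"
      unfolding orth_compl_graph_system using M by (auto simp: K1_def K2_def K3_def mat_def)
    ultimately show "?L t"
      using psd by (intro exI[of _ K1] exI[of _ K2] exI[of _ K3]) simp
  qed
  then show ?thesis by (simp add: osy_norm_def)
qed

lemma feasible_nonneg:
  assumes "t \<in> feasible G X"
  shows "0 \<le> t"
proof -
  obtain M where psd: "pos_semidef M"
      and M: "\<And>x y. (x, y) \<in> doubled_pattern G \<Longrightarrow> M $ x $ y = partial_block t X $ x $ y"
    using assms unfolding feasible_def by blast
  have "M $ Inl i $ Inl i = of_real t" for i using M by simp
  then show ?thesis using pos_semidef_diag[OF psd] by (metis Re_complex_of_real)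
qed

lemma feasible_bdd_below: "bdd_below (feasible G X)"
  using feasible_nonneg by (rule bdd_belowI)

lemma feasible_nonempty: "feasible G X \<noteq> {}"
proof -
  obtain c where c: "pos_semidef (partial_block 0 X + mat (of_real c))"
    using hermitian_plus_large_mat_pos_semidef[of "partial_block 0 X"] partial_block_hermitian by blast
  have "(partial_block 0 X + mat (of_real c)) $ x $ y = partial_block c X $ x $ y" for x y
    by (cases x; cases y) (auto simp: mat_def)
  then have "partial_block 0 X + mat (of_real c) = partial_block c X"
    by (simp add: vec_eq_iff)
  with c have "c \<in> feasible G X" unfolding feasible_def by auto
  then show ?thesis by blast
qed

section \<open>Tensor products of completions\<close>

text \<open>
  The compression of the tensor product of two block matrices to the two corners where the block
  indices agree: each block of the result is the Kronecker product of the blocks in that place.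
\<close>

definition block_tensor ::
  "complex^('n + 'n)^('n + 'n) \<Rightarrow> complex^('m + 'm)^('m + 'm)
    \<Rightarrow> complex^('n::finite \<times> 'm::finite + 'n \<times> 'm)^('n \<times> 'm + 'n \<times> 'm)"
  where "block_tensor = pullback_mult (map_sum fst fst) (map_sum snd snd)"

lemma pos_semidef_block_tensor:
  "pos_semidef M \<Longrightarrow> pos_semidef N \<Longrightarrow> pos_semidef (block_tensor M N)"
  by (simp add: block_tensor_def pos_semidef_pullback_mult)

lemma block_tensor_nth:
  "block_tensor M N $ x $ y
    = M $ map_sum fst fst x $ map_sum fst fst y * N $ map_sum snd snd x $ map_sum snd snd y"
  by (simp add: block_tensor_def pullback_mult_def)

lemma partial_block_kronecker:
  "partial_block (s * t) (kronecker X Y) = block_tensor (partial_block s X) (partial_block t Y)"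
proof -
  have "partial_block (s * t) (kronecker X Y) $ x $ y
      = block_tensor (partial_block s X) (partial_block t Y) $ x $ y" for x y
    by (cases x; cases y) (auto simp: block_tensor_nth kronecker_def prod_eq_iff)
  then show ?thesis by (simp add: vec_eq_iff)
qed

lemma doubled_pattern_strong_product:
  "(x, y) \<in> doubled_pattern (strong_product G H) \<longleftrightarrow>
    (map_sum fst fst x, map_sum fst fst y) \<in> doubled_pattern G \<and>
    (map_sum snd snd x, map_sum snd snd y) \<in> doubled_pattern H"
proof -
  have "(p, q) \<in> strong_product G H \<union> Id \<longleftrightarrow> (fst p, fst q) \<in> G \<union> Id \<and> (snd p, snd q) \<in> H \<union> Id" for p q
    by (cases p; cases q) (auto simp: strong_product_def)
  then show ?thesis by (cases x; cases y) simp_all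
qed

lemma feasible_mult:
  assumes "s \<in> feasible G X" and "t \<in> feasible H Y"
  shows "s * t \<in> feasible (strong_product G H) (kronecker X Y)"
proof -
  obtain M N where "pos_semidef M" "pos_semidef N"
    and MN: "\<And>x y. (x, y) \<in> doubled_pattern G \<Longrightarrow> M $ x $ y = partial_block s X $ x $ y"
      "\<And>x y. (x, y) \<in> doubled_pattern H \<Longrightarrow> N $ x $ y = partial_block t Y $ x $ y"
    using assms unfolding feasible_def by blast
  then have "pos_semidef (block_tensor M N)" by (simp add: pos_semidef_block_tensor)
  moreover have "block_tensor M N $ x $ y = partial_block (s * t) (kronecker X Y) $ x $ y"
    if "(x, y) \<in> doubled_pattern (strong_product G H)" for x y
    using that MN by (simp add: partial_block_kronecker block_tensor_nth doubled_pattern_strong_product)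
  ultimately show ?thesis unfolding feasible_def by blast
qed

section \<open>Dual certificates and weak duality\<close>

lemma sum_UNIV_sum: "(\<Sum>x\<in>(UNIV :: ('a::finite + 'b::finite) set). f x) = (\<Sum>i\<in>UNIV. f (Inl i)) + (\<Sum>i\<in>UNIV. f (Inr i))"
  unfolding UNIV_Plus_UNIV[symmetric] by (subst sum.Plus) (simp_all)

lemma sum_diagonal:
  fixes c :: "'a::comm_semiring_1"
  shows "(\<Sum>i\<in>UNIV. \<Sum>j\<in>UNIV. (if i = j then c else 0) * f i j) = c * (\<Sum>i\<in>(UNIV::'k::finite set). f i i)"
proof -
  have "(\<Sum>j\<in>UNIV. (if i = j then c else 0) * f i j) = (\<Sum>j\<in>UNIV. if i = j then c * f i j else 0)" for i
    by (intro sum.cong refl) simp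
  then show ?thesis by (simp add: sum_distrib_left)
qed

definition ltrace :: "complex^('n + 'n)^('n + 'n::finite) \<Rightarrow> complex" where
  "ltrace W = (\<Sum>i\<in>UNIV. W $ Inl i $ Inl i)"

definition rtrace :: "complex^('n + 'n)^('n + 'n::finite) \<Rightarrow> complex" where
  "rtrace W = (\<Sum>i\<in>UNIV. W $ Inr i $ Inr i)"

text \<open>
  The bilinear pairing with the upper right block. Having no complex conjugation here lets weak
  duality use the entrywise product with \<open>W\<close> itself.
\<close>

definition pairing :: "complex^'n^'n \<Rightarrow> complex^('n + 'n)^('n + 'n::finite) \<Rightarrow> complex" where
  "pairing X W = (\<Sum>i\<in>UNIV. \<Sum>j\<in>UNIV. X $ i $ j * W $ Inl i $ Inr j)"

text \<open>
  Bounding the product of the two traces, where the dual programme bounds their sum, makes the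
  condition stable under tensoring and invariant under rescaling the two blocks against each other.
\<close>

definition dual_certificate :: "'n rel \<Rightarrow> complex^('n + 'n)^('n + 'n::finite) \<Rightarrow> bool" where
  "dual_certificate G W \<longleftrightarrow> pos_semidef W \<and> (\<forall>x y. (x, y) \<notin> doubled_pattern G \<longrightarrow> W $ x $ y = 0)
     \<and> Re (ltrace W) * Re (rtrace W) \<le> 1"

lemma ltrace_pos_semidef: "pos_semidef W \<Longrightarrow> ltrace W \<in> \<real> \<and> 0 \<le> Re (ltrace W)"
  unfolding ltrace_def using pos_semidef_diag by (auto intro!: sum_in_Reals sum_nonneg)

lemma rtrace_pos_semidef: "pos_semidef W \<Longrightarrow> rtrace W \<in> \<real> \<and> 0 \<le> Re (rtrace W)"
  unfolding rtrace_def using pos_semidef_diag by (auto intro!: sum_in_Reals sum_nonneg)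

text \<open>
  Off the pattern the unknown entries of the completion \<open>M\<close> meet zeros of \<open>W\<close>, so the entrywise product
  of \<open>M\<close> and \<open>W\<close> is known. Its form at the indicator vectors of the two blocks consists of
  \<open>t tr P\<close>, \<open>t tr Q\<close> and the pairing, and Cauchy--Schwarz relates them.
\<close>

lemma weak_duality:
  fixes X :: "complex^'n^'n"
  assumes t: "t \<in> feasible G X" and W: "dual_certificate G W"
  shows "cmod (pairing X W) \<le> t"
proof -
  obtain M where psd: "pos_semidef M"
    and M: "\<And>x y. (x, y) \<in> doubled_pattern G \<Longrightarrow> M $ x $ y = partial_block t X $ x $ y"
    using t unfolding feasible_def by blast
  define N where "N = pullback_mult id id M W"
  have N: "pos_semidef N" unfolding N_def
    using psd W by (simp add: pos_semidef_pullback_mult dual_certificate_def)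
  have Nth: "N $ x $ y = partial_block t X $ x $ y * W $ x $ y" for x y
    using M W by (cases "(x, y) \<in> doubled_pattern G")
      (simp_all add: N_def pullback_mult_def dual_certificate_def)
  define u v :: "complex^('n + 'n)"
    where "u = (\<chi> x. case x of Inl _ \<Rightarrow> 1 | Inr _ \<Rightarrow> 0)" and "v = (\<chi> x. case x of Inl _ \<Rightarrow> 0 | Inr _ \<Rightarrow> 1)"
  have uv: "sesq N u v = pairing X W"
    by (simp add: sesq_alt sum_UNIV_sum Nth u_def v_def pairing_def)
  have uu: "sesq N u u = of_real t * ltrace W"
    by (simp add: sesq_alt sum_UNIV_sum Nth u_def ltrace_def sum_diagonal)
  have vv: "sesq N v v = of_real t * rtrace W"
    by (simp add: sesq_alt sum_UNIV_sum Nth v_def rtrace_def sum_diagonal)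
  have "(cmod (pairing X W))\<^sup>2 \<le> t\<^sup>2 * (Re (ltrace W) * Re (rtrace W))"
    using pos_semidef_Cauchy_Schwarz[OF N, of u v]
    by (simp add: uv uu vv power2_eq_square algebra_simps)
  also have "\<dots> \<le> t\<^sup>2 * 1"
    using W by (intro mult_left_mono) (auto simp: dual_certificate_def)
  finally have "(cmod (pairing X W))\<^sup>2 \<le> t\<^sup>2" by simp
  then show ?thesis using feasible_nonneg[OF t] by (rule power2_le_imp_le)
qed

lemma sum_UNIV_prod:
  "(\<Sum>p\<in>(UNIV :: ('a::finite \<times> 'b::finite) set). f p) = (\<Sum>i\<in>UNIV. \<Sum>j\<in>UNIV. f (i, j))"
  by (simp only: sum.cartesian_product UNIV_Times_UNIV case_prod_eta)

lemma ltrace_block_tensor: "ltrace (block_tensor V W) = ltrace V * ltrace W"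
  by (simp add: ltrace_def block_tensor_nth sum_UNIV_prod sum_product)

lemma rtrace_block_tensor: "rtrace (block_tensor V W) = rtrace V * rtrace W"
  by (simp add: rtrace_def block_tensor_nth sum_UNIV_prod sum_product)

lemma pairing_block_tensor: "pairing (kronecker X Y) (block_tensor V W) = pairing X V * pairing Y W"
proof -
  have "pairing (kronecker X Y) (block_tensor V W)
    = (\<Sum>i\<in>UNIV. \<Sum>j\<in>UNIV. \<Sum>k\<in>UNIV. \<Sum>l\<in>UNIV.
        (X $ i $ k * V $ Inl i $ Inr k) * (Y $ j $ l * W $ Inl j $ Inr l))"
    by (simp add: pairing_def block_tensor_nth kronecker_def sum_UNIV_prod algebra_simps)
  also have "\<dots> = pairing X V * pairing Y W"
    by (simp add: pairing_def sum_product)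
  finally show ?thesis .
qed

lemma dual_certificate_block_tensor:
  assumes "dual_certificate G V" and "dual_certificate H W"
  shows "dual_certificate (strong_product G H) (block_tensor V W)"
proof -
  have psd: "pos_semidef V" "pos_semidef W" using assms by (auto simp: dual_certificate_def)
  have "Re (ltrace (block_tensor V W)) * Re (rtrace (block_tensor V W))
      = (Re (ltrace V) * Re (rtrace V)) * (Re (ltrace W) * Re (rtrace W))"
    using psd[THEN ltrace_pos_semidef] psd[THEN rtrace_pos_semidef]
    by (simp add: ltrace_block_tensor rtrace_block_tensor complex_is_Real_iff)
  also have "\<dots> \<le> 1"
    using assms psd[THEN ltrace_pos_semidef] psd[THEN rtrace_pos_semidef]
    by (auto simp: dual_certificate_def intro: mult_le_one)
  finally show ?thesis
    using assms by (auto simp: dual_certificate_def pos_semidef_block_tensor block_tensor_nth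
        doubled_pattern_strong_product)
qed


section \<open>Strong duality\<close>

lemma inner_matrix: "inner A B = Re (\<Sum>i\<in>UNIV. \<Sum>j\<in>UNIV. cnj (A $ i $ j) * B $ i $ j)"
  for A :: "complex^'k^'k"
  by (simp add: inner_vec_def inner_complex_def)

lemma conj_transpose_nth [simp]: "conj_transpose A $ i $ j = cnj (A $ j $ i)"
  by (simp add: conj_transpose_def)

text \<open>
  The positive semidefinite matrices have empty interior among all complex matrices. Adding arbitrary
  skew-Hermitian parts repairs this, so that the identity is an interior point and a nonzero
  functional that is nonnegative on the set is positive there.
\<close>

definition hermitian_part_psd :: "(complex^'k^'k::finite) set" where
  "hermitian_part_psd = {N. pos_semidef (N + conj_transpose N)}"

lemma convex_hermitian_part_psd: "convex (hermitian_part_psd :: (complex^'k^'k::finite) set)"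
proof (rule convexI)
  fix M N :: "complex^'k^'k" and r s :: real
  assume "M \<in> hermitian_part_psd" "N \<in> hermitian_part_psd" "0 \<le> r" "0 \<le> s"
  moreover have "(r *\<^sub>R M + s *\<^sub>R N) + conj_transpose (r *\<^sub>R M + s *\<^sub>R N)
      = r *\<^sub>R (M + conj_transpose M) + s *\<^sub>R (N + conj_transpose N)"
    by (simp add: vec_eq_iff algebra_simps)
  ultimately show "r *\<^sub>R M + s *\<^sub>R N \<in> hermitian_part_psd"
    by (simp add: hermitian_part_psd_def pos_semidef_add pos_semidef_scaleR)
qed

text \<open>
  The set contains all skew-Hermitian matrices and their negatives, so \<open>a\<close> vanishes on them, which
  means that \<open>a\<close> is Hermitian; testing on rank-one matrices gives positivity. The conjugate appears
  because the real inner product is \<open>Re (\<Sum> cnj a\<^sub>i\<^sub>j N\<^sub>i\<^sub>j)\<close>.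
\<close>

lemma dual_cone_hermitian_part_psd:
  fixes a :: "complex^'k^'k"
  assumes nonneg: "\<And>N. N \<in> hermitian_part_psd \<Longrightarrow> 0 \<le> inner a N"
  shows "pos_semidef (\<chi> i j. cnj (a $ i $ j))" (is ?psd)
    and "a \<noteq> 0 \<Longrightarrow> 0 < inner a (mat 1)"
proof -
  have skew: "inner a (N - conj_transpose N) = 0" for N
  proof -
    have "(N - conj_transpose N) + conj_transpose (N - conj_transpose N) = 0"
      and "(conj_transpose N - N) + conj_transpose (conj_transpose N - N) = 0"
      by (simp_all add: vec_eq_iff)
    then have "N - conj_transpose N \<in> hermitian_part_psd" "conj_transpose N - N \<in> hermitian_part_psd"
      unfolding hermitian_part_psd_def using pos_semidef_zero by simp_all
    then have "0 \<le> inner a (N - conj_transpose N)" "0 \<le> inner a (conj_transpose N - N)"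
      using nonneg by blast+
    then show ?thesis by (simp add: inner_diff_right)
  qed
  have herm: "a $ j $ i = cnj (a $ i $ j)" for i j
  proof -
    have eq: "inner (a $ i $ j) c = inner (a $ j $ i) (cnj c)" for c
    proof -
      have "conj_transpose (axis i (axis j c)) = axis j (axis i (cnj c))"
        by (simp add: vec_eq_iff axis_def)
      then show ?thesis
        using skew[of "axis i (axis j c)"] by (simp add: inner_diff_right inner_axis)
    qed
    show ?thesis using eq[of 1] eq[of \<i>] by (simp add: inner_complex_def complex_eq_iff)
  qed
  show ?psd
    unfolding pos_semidef_iff_sesq
  proof (intro allI conjI)
    fix v :: "complex^'k"
    show "sesq (\<chi> i j. cnj (a $ i $ j)) v v \<in> \<real>"
      by (rule sesq_self_real_of_hermitian) (simp, metis herm)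
    define w :: "complex^'k" where "w = (\<chi> i. cnj (v $ i))"
    have "conj_transpose (outer w) = outer w" by (simp add: outer_def vec_eq_iff mult.commute)
    then have "outer w \<in> hermitian_part_psd"
      unfolding hermitian_part_psd_def mem_Collect_eq
      by (simp only: pos_semidef_outer pos_semidef_add)
    then have "0 \<le> inner a (outer w)" by (rule nonneg)
    also have "inner a (outer w) = Re (sesq (\<chi> i j. cnj (a $ i $ j)) v v)"
      by (simp add: inner_matrix sesq_alt outer_def w_def algebra_simps)
    finally show "0 \<le> Re (sesq (\<chi> i j. cnj (a $ i $ j)) v v)" .
  qed
  show "0 < inner a (mat 1)" if "a \<noteq> 0"
  proof (rule ccontr)
    assume "\<not> 0 < inner a (mat 1)"
    \<comment> \<open>For a large multiple of the identity, \<open>r I - a\<close> lies in the set; if the functional did not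
      exceed 0 at the identity, it would give \<open>- a \<bullet> a \<ge> 0\<close>.\<close>
    have "(- (2 *\<^sub>R a)) $ j $ i = cnj ((- (2 *\<^sub>R a)) $ i $ j)" for i j
      by (simp add: herm[of j i])
    then obtain c where c: "pos_semidef (- (2 *\<^sub>R a) + mat (of_real c))"
      using hermitian_plus_large_mat_pos_semidef[of "- (2 *\<^sub>R a)"] by blast
    define r where "r = \<bar>c\<bar> / 2"
    have "- a + r *\<^sub>R mat 1 + conj_transpose (- a + r *\<^sub>R mat 1)
        = (- (2 *\<^sub>R a) + mat (of_real c)) + mat (of_real (\<bar>c\<bar> - c))"
      by (simp add: vec_eq_iff mat_def r_def herm[symmetric] complex_eq_iff)
    moreover have "pos_semidef (mat (of_real (\<bar>c\<bar> - c)) :: complex^'k^'k)"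
      unfolding pos_semidef_iff_sesq sesq_mat by simp
    ultimately have "- a + r *\<^sub>R mat 1 \<in> hermitian_part_psd"
      using c by (simp add: hermitian_part_psd_def pos_semidef_add)
    from nonneg[OF this] have "inner a a \<le> r * inner a (mat 1)"
      by (simp add: inner_diff_right inner_add_right)
    also have "\<dots> \<le> 0" using \<open>\<not> 0 < inner a (mat 1)\<close> by (simp add: r_def mult_nonneg_nonpos)
    finally show False using that inner_gt_zero_iff[of a] by linarith
  qed
qed

text \<open>
  Below the norm no completion exists, so the convex set of matrices with prescribed pattern entries
  for some \<open>t\<close> below the norm \<open>\<sigma>\<close> is disjoint from the convex cone of matrices with positive
  semidefinite Hermitian part. Let \<open>a\<close> separate them. Entries off the pattern are free, hence \<open>a\<close>
  vanishes there; on the cone \<open>a\<close> is nonnegative, hence its conjugate \<open>V\<close> is positive semidefinite with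
  trace \<open>\<tau> > 0\<close>; and evaluating \<open>a\<close> at the block matrices for \<open>t < \<sigma>\<close> gives
  \<open>t \<tau> + 2 Re (pairing X V) \<le> 0\<close>. Letting \<open>t\<close> tend to \<open>\<sigma>\<close> bounds \<open>\<sigma>\<close> by the pairing with \<open>V\<close>, normalised
  to trace 2.
\<close>

lemma strong_duality:
  fixes X :: "complex^'n^'n"
  assumes G: "is_graph G"
  shows "\<exists>W. dual_certificate G W \<and> osy_norm G X \<le> cmod (pairing X W)"
proof -
  define \<sigma> where "\<sigma> = osy_norm G X"
  define A where "A = {M. \<exists>t<\<sigma>. \<forall>(x, y)\<in>doubled_pattern G. M $ x $ y = partial_block t X $ x $ y}"
  have pattern_sym: "(y, x) \<in> doubled_pattern G" if "(x, y) \<in> doubled_pattern G" for x y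
    using G that by (auto simp: doubled_pattern_def is_graph_def dest: symD)
  have affine: "partial_block (r * s + q * t) X = r *\<^sub>R partial_block s X + q *\<^sub>R partial_block t X"
    if "r + q = 1" for r q s t
  proof -
    have q: "q = 1 - r" using that by simp
    have "partial_block (r * s + q * t) X $ x $ y
        = (r *\<^sub>R partial_block s X + q *\<^sub>R partial_block t X) $ x $ y" for x y
      by (cases x; cases y) (simp_all add: q complex_eq_iff algebra_simps)
    then show ?thesis by (simp add: vec_eq_iff)
  qed
  have target: "partial_block t X \<in> A" if "t < \<sigma>" for t
    using that by (auto simp: A_def)
  have "convex A"
  proof (rule convexI)
    fix M N :: "complex^('n + 'n)^('n + 'n)" and r q :: real
    assume MN: "M \<in> A" "N \<in> A" and r: "0 \<le> r" "0 \<le> q" "r + q = 1"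
    then obtain s t where st: "s < \<sigma>" "t < \<sigma>"
      and eq: "\<forall>(x, y)\<in>doubled_pattern G. M $ x $ y = partial_block s X $ x $ y"
      "\<forall>(x, y)\<in>doubled_pattern G. N $ x $ y = partial_block t X $ x $ y"
      by (auto simp: A_def)
    have "r * s + q * t < \<sigma>" using st r convex_bound_lt[of s \<sigma> t r q] by simp
    moreover have "\<forall>(x, y)\<in>doubled_pattern G.
        (r *\<^sub>R M + q *\<^sub>R N) $ x $ y = partial_block (r * s + q * t) X $ x $ y"
      using eq r by (auto simp: affine split_beta)
    ultimately show "r *\<^sub>R M + q *\<^sub>R N \<in> A" unfolding A_def by blast
  qed
  moreover have "A \<inter> hermitian_part_psd = {}"
  proof (rule ccontr)
    assume "A \<inter> hermitian_part_psd \<noteq> {}"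
    then obtain M t where psd: "pos_semidef (M + conj_transpose M)" and t: "t < \<sigma>"
      and M: "\<forall>(x, y)\<in>doubled_pattern G. M $ x $ y = partial_block t X $ x $ y"
      by (auto simp: A_def hermitian_part_psd_def)
    \<comment> \<open>Averaging with the adjoint keeps the prescribed entries, since the pattern is symmetric and
      the prescribed block matrix is Hermitian.\<close>
    have "((1/2) *\<^sub>R (M + conj_transpose M)) $ x $ y = partial_block t X $ x $ y"
      if "(x, y) \<in> doubled_pattern G" for x y
    proof -
      have "M $ x $ y = partial_block t X $ x $ y" "M $ y $ x = partial_block t X $ y $ x"
        using M that pattern_sym[OF that] by auto
      then show ?thesis
        using partial_block_hermitian[of t X y x] by (simp add: complex_eq_iff)
    qed
    moreover have "pos_semidef ((1/2) *\<^sub>R (M + conj_transpose M))"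
      using psd by (rule pos_semidef_scaleR) simp
    ultimately have "t \<in> feasible G X" unfolding feasible_def by blast
    then have "\<sigma> \<le> t"
      by (simp add: \<sigma>_def osy_norm_eq_Inf_feasible[OF G] cInf_lower feasible_bdd_below)
    with t show False by simp
  qed
  moreover have "0 \<in> (hermitian_part_psd :: (complex^('n + 'n)^('n + 'n)) set)"
  proof -
    have "(0 :: complex^('n + 'n)^('n + 'n)) + conj_transpose 0 = 0" by (simp add: vec_eq_iff)
    then show ?thesis using pos_semidef_zero by (simp add: hermitian_part_psd_def)
  qed
  moreover have "A \<noteq> {}" using target[of "\<sigma> - 1"] by auto
  ultimately obtain a b where a0: "a \<noteq> 0" and ub: "\<And>M. M \<in> A \<Longrightarrow> inner a M \<le> b"
    and lb: "\<And>N. N \<in> hermitian_part_psd \<Longrightarrow> b \<le> inner a N"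
    using separating_hyperplane_sets[of A hermitian_part_psd] convex_hermitian_part_psd by blast
  have b0: "b \<le> 0" using lb[OF \<open>0 \<in> hermitian_part_psd\<close>] by simp
  have nonneg: "0 \<le> inner a N" if N: "N \<in> hermitian_part_psd" for N
  proof (rule ccontr)
    assume neg: "\<not> 0 \<le> inner a N"
    \<comment> \<open>The set is a cone; this multiple of \<open>N\<close> would give the functional the value \<open>b - 1\<close>.\<close>
    define r where "r = (b - 1) / inner a N"
    have "0 \<le> r" using neg b0 by (simp add: r_def divide_nonpos_nonpos)
    moreover have "r *\<^sub>R N + conj_transpose (r *\<^sub>R N) = r *\<^sub>R (N + conj_transpose N)"
      by (simp add: vec_eq_iff algebra_simps)
    ultimately have "r *\<^sub>R N \<in> hermitian_part_psd"
      using N by (simp add: hermitian_part_psd_def pos_semidef_scaleR)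
    from lb[OF this] show False using neg by (simp add: r_def)
  qed
  have supp: "a $ x $ y = 0" if "(x, y) \<notin> doubled_pattern G" for x y
  proof (rule ccontr)
    assume nz: "a $ x $ y \<noteq> 0"
    define M where "M = partial_block (\<sigma> - 1) X"
    define n where "n = inner (a $ x $ y) (a $ x $ y)"
    have n: "n > 0" using nz by (simp add: n_def)
    \<comment> \<open>Moving the free entry in the direction of \<open>a\<close> by this amount raises the functional to \<open>b + 1\<close>.\<close>
    define r where "r = (b + 1 - inner a M) / n"
    have "\<forall>(x', y')\<in>doubled_pattern G.
        (M + r *\<^sub>R axis x (axis y (a $ x $ y))) $ x' $ y' = partial_block (\<sigma> - 1) X $ x' $ y'"
    proof -
      have "axis x (axis y (a $ x $ y)) $ x' $ y' = (if x' = x \<and> y' = y then a $ x $ y else 0)"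
        for x' y' by (simp add: axis_def)
      then show ?thesis using that by (auto simp: M_def)
    qed
    then have "M + r *\<^sub>R axis x (axis y (a $ x $ y)) \<in> A"
      unfolding A_def by (intro CollectI exI[of _ "\<sigma> - 1"]) simp
    from ub[OF this] have "inner a M + r * n \<le> b"
      by (simp add: inner_add_right inner_axis n_def)
    then show False using n by (simp add: r_def)
  qed
  define \<tau> where "\<tau> = inner a (mat 1)"
  have \<tau>: "\<tau> > 0" using dual_cone_hermitian_part_psd(2)[OF nonneg a0] by (simp add: \<tau>_def)
  define V where "V = (\<chi> x y. cnj (a $ x $ y))"
  have V: "pos_semidef V" using dual_cone_hermitian_part_psd(1)[OF nonneg] by (simp add: V_def)
  have inner_V: "inner a M = Re (\<Sum>x\<in>UNIV. \<Sum>y\<in>UNIV. M $ x $ y * V $ x $ y)" for M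
    by (simp add: inner_matrix V_def mult.commute)
  have \<tau>_eq: "\<tau> = Re (ltrace V) + Re (rtrace V)"
    by (simp add: \<tau>_def inner_V mat_def sum_diagonal)
      (simp add: sum_UNIV_sum ltrace_def rtrace_def)
  have inner_block: "inner a (partial_block t X) = t * \<tau> + 2 * Re (pairing X V)" for t
  proof -
    have "(\<Sum>i\<in>UNIV. \<Sum>j\<in>UNIV. cnj (X $ j $ i) * V $ Inr i $ Inl j) = cnj (pairing X V)"
      unfolding pairing_def cnj_sum complex_cnj_mult pos_semidef_hermitian[OF V, symmetric]
      by (rule sum.swap)
    then have "(\<Sum>x\<in>UNIV. \<Sum>y\<in>UNIV. partial_block t X $ x $ y * V $ x $ y)
        = of_real t * ltrace V + of_real t * rtrace V + (pairing X V + cnj (pairing X V))"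
      by (simp add: sum_UNIV_sum sum.distrib sum_diagonal ltrace_def rtrace_def
          flip: pairing_def)
    then show ?thesis
      by (simp add: inner_V \<tau>_eq distrib_left)
  qed
  have "\<sigma> \<le> - 2 * Re (pairing X V) / \<tau>"
  proof (rule dense_le)
    fix t assume "t < \<sigma>"
    then have "t * \<tau> + 2 * Re (pairing X V) \<le> 0"
      using ub[OF target] b0 inner_block[of t] by fastforce
    then show "t \<le> - 2 * Re (pairing X V) / \<tau>" using \<tau> by (simp add: field_simps)
  qed
  also have "\<dots> \<le> 2 * cmod (pairing X V) / \<tau>"
    using \<tau> abs_Re_le_cmod[of "pairing X V"] by (intro divide_right_mono) auto
  finally have bound: "\<sigma> \<le> 2 / \<tau> * cmod (pairing X V)" by simp
  define W where "W = (2 / \<tau>) *\<^sub>R V"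
  have W: "pos_semidef W" using V \<tau> by (simp add: W_def pos_semidef_scaleR)
  have "pairing X W = (2 / \<tau>) *\<^sub>R pairing X V" by (simp add: pairing_def W_def scaleR_sum_right)
  then have "cmod (pairing X W) = 2 / \<tau> * cmod (pairing X V)" using \<tau> by simp
  moreover have "dual_certificate G W"
  proof -
    define p q where "p = Re (ltrace W)" and "q = Re (rtrace W)"
    have "p = 2 / \<tau> * Re (ltrace V)" "q = 2 / \<tau> * Re (rtrace V)"
      by (simp_all add: p_def q_def W_def ltrace_def rtrace_def sum_distrib_left sum_divide_distrib)
    then have "p + q = 2 / \<tau> * \<tau>" using \<tau>_eq by (simp only: distrib_left)
    then have "p + q = 2" using \<tau> by simp
    \<comment> \<open>The traces of the blocks add up to 2, so their product is at most 1.\<close>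
    have "4 * (p * q) = (p + q)\<^sup>2 - (p - q)\<^sup>2"
      by (simp add: power2_eq_square algebra_simps)
    also have "\<dots> \<le> 4" using \<open>p + q = 2\<close> by simp
    finally have "p * q \<le> 1" by simp
    then show ?thesis
      using W supp by (simp add: dual_certificate_def p_def q_def W_def V_def)
  qed
  ultimately show ?thesis using bound by (auto simp: \<sigma>_def)
qed

section \<open>Multiplicativity of the quotient norm\<close>

lemma le_Inf_times:
  fixes S :: "real set"
  assumes "S \<noteq> {}" and "0 \<le> t" and "\<And>s. s \<in> S \<Longrightarrow> c \<le> s * t"
  shows "c \<le> Inf S * t"
proof (cases "t = 0")
  case True
  moreover obtain s where "s \<in> S" using assms(1) by blast
  ultimately show ?thesis using assms(3)[of s] by simp
next
  case False
  then have "c / t \<le> Inf S" using assms by (intro cInf_greatest) (auto simp: field_simps)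
  then show ?thesis using False assms(2) by (simp add: field_simps)
qed

theorem theorem5p4:
  fixes G :: "'n::finite rel" and H :: "'m::finite rel"
    and X :: "complex^'n^'n" and Y :: "complex^'m^'m"
  assumes "is_graph G" and "is_graph H"
  shows "osy_norm G X * osy_norm H Y = osy_norm (strong_product G H) (kronecker X Y)"
proof -
  let ?P = "strong_product G H" and ?Z = "kronecker X Y"
  have P: "is_graph ?P"
    using assms by (auto simp: is_graph_def strong_product_def sym_def irrefl_def)
  note Inf = osy_norm_eq_Inf_feasible[OF assms(1)] osy_norm_eq_Inf_feasible[OF assms(2)]
    osy_norm_eq_Inf_feasible[OF P]
  have nonneg: "0 \<le> osy_norm G X" "0 \<le> osy_norm H Y"
    unfolding Inf by (auto intro!: cInf_greatest feasible_nonempty dest: feasible_nonneg)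
  show ?thesis
  proof (rule antisym)
    obtain V W where V: "dual_certificate G V" "osy_norm G X \<le> cmod (pairing X V)"
      and W: "dual_certificate H W" "osy_norm H Y \<le> cmod (pairing Y W)"
      using strong_duality[OF assms(1)] strong_duality[OF assms(2)] by blast
    show "osy_norm G X * osy_norm H Y \<le> osy_norm ?P ?Z"
      unfolding Inf(3)
    proof (rule cInf_greatest[OF feasible_nonempty])
      fix t assume t: "t \<in> feasible ?P ?Z"
      have "osy_norm G X * osy_norm H Y \<le> cmod (pairing X V) * cmod (pairing Y W)"
        using V W nonneg by (intro mult_mono) auto
      also have "\<dots> = cmod (pairing ?Z (block_tensor V W))"
        by (simp add: pairing_block_tensor norm_mult)
      also have "\<dots> \<le> t"
        using t dual_certificate_block_tensor[OF V(1) W(1)] by (rule weak_duality)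
      finally show "osy_norm G X * osy_norm H Y \<le> t" .
    qed
  next
    have "osy_norm ?P ?Z \<le> s * t" if "s \<in> feasible G X" "t \<in> feasible H Y" for s t
      unfolding Inf(3) using feasible_mult[OF that] by (simp add: cInf_lower feasible_bdd_below)
    then have "osy_norm ?P ?Z \<le> osy_norm G X * t" if "t \<in> feasible H Y" for t
      unfolding Inf(1) using le_Inf_times[OF feasible_nonempty feasible_nonneg[OF that]] that by blast
    then have "osy_norm ?P ?Z \<le> t * osy_norm G X" if "t \<in> feasible H Y" for t
      using that by (simp add: mult.commute)
    from le_Inf_times[OF feasible_nonempty nonneg(1) this]
    show "osy_norm ?P ?Z \<le> osy_norm G X * osy_norm H Y"
      by (simp add: Inf(2) mult.commute)
  qed
qed

end
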